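(* Let $n$ be a nonnegative integer. The metric projection $P_{\mathcal{P}_n}:C[0,1]\to\mathcal{P}_n$ is a single-valued mapping; that is, for every $f\in C[0,1]$ the set $P_{\mathcal{P}_n}(f)$ consists of exactly one element.
   Context: $C[0,1]$ is the Banach space of continuous real-valued functions on $[0,1]$ with norm $\|f\|=\max_{0\le t\le1}|f(t)|$. $\mathcal{P}_n$ is the closed subspace of $C[0,1]$ consisting of all polynomials with real coefficients of degree less than or equal to $n$. The metric projection is $P_{\mathcal{P}_n}(f)=\{p\in\mathcal{P}_n:\|f-p\|\le\|f-q\|\text{ for all }q\in\mathcal{P}_n\}$. *)

theory Defs
  imports "HOL-Analysis.Analysis" "HOL-Computational_Algebra.Polynomial"
begin

typedef unit_interval = "{0..1::real}"
  morphisms real_of_unit unit_of_real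
  by (rule exI[of _ 0]) simp

instantiation unit_interval :: metric_space
begin

definition dist_unit_interval :: "unit_interval \<Rightarrow> unit_interval \<Rightarrow> real"
  where "dist_unit_interval s t = dist (real_of_unit s) (real_of_unit t)"

definition uniformity_unit_interval :: "(unit_interval \<times> unit_interval) filter"
  where "uniformity_unit_interval = (INF e\<in>{0 <..}. principal {(s, t). dist s t < e})"

definition open_unit_interval :: "unit_interval set \<Rightarrow> bool"
  where "open_unit_interval U \<longleftrightarrow>
    (\<forall>t\<in>U. \<forall>\<^sub>F (s, s') in uniformity. s = t \<longrightarrow> s' \<in> U)"

instance
proof
  fix s t u :: unit_interval
  show "dist s t = 0 \<longleftrightarrow> s = t"
    by (simp add: dist_unit_interval_def real_of_unit_inject)
  show "dist s t \<le> dist s u + dist t u"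
    unfolding dist_unit_interval_def by (rule dist_triangle2)
qed (simp_all add: uniformity_unit_interval_def open_unit_interval_def)

end

lemma continuous_on_real_of_unit: "continuous_on S real_of_unit"
  unfolding continuous_on_iff by (auto simp: dist_unit_interval_def)

lemma continuous_on_unit_of_real: "continuous_on {0..1} unit_of_real"
  unfolding continuous_on_iff
  by (auto simp: dist_unit_interval_def unit_of_real_inverse)

lemma compact_UNIV_unit_interval: "compact (UNIV :: unit_interval set)"
proof -
  have "unit_of_real ` {0..1} = UNIV"
    using type_definition.Abs_image[OF type_definition_unit_interval] .
  then show ?thesis
    using compact_continuous_image[OF continuous_on_unit_of_real compact_Icc] by simp
qed

text \<open>The space \<open>C[0,1]\<close>, with the supremum norm, is the library's Banach space of bounded
  continuous functions on \<open>[0,1]\<close>. Since \<open>[0,1]\<close> is compact, boundedness is no restriction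
  and the supremum is a maximum; the two lemmas below record this.\<close>

type_synonym C01 = "unit_interval \<Rightarrow>\<^sub>C real"

lemma bcontfun_unit_interval_iff:
  fixes g :: "unit_interval \<Rightarrow> real"
  shows "g \<in> bcontfun \<longleftrightarrow> continuous_on UNIV g"
  using compact_imp_bounded[OF compact_continuous_image[OF _ compact_UNIV_unit_interval]]
  by (auto simp: bcontfun_def)

lemma norm_C01_is_max:
  fixes f :: C01
  shows "\<exists>t. norm f = \<bar>apply_bcontfun f t\<bar>" and "\<bar>apply_bcontfun f s\<bar> \<le> norm f"
proof -
  show le: "\<bar>apply_bcontfun f s\<bar> \<le> norm f" for s
    using norm_bounded[of f s] by simp
  have "continuous_on UNIV (\<lambda>t. \<bar>apply_bcontfun f t\<bar>)"
    by (intro continuous_intros) auto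
  then obtain t where t: "\<And>s. \<bar>apply_bcontfun f s\<bar> \<le> \<bar>apply_bcontfun f t\<bar>"
    using continuous_attains_sup[OF compact_UNIV_unit_interval] by auto
  have "norm f \<le> \<bar>apply_bcontfun f t\<bar>"
    by (rule norm_bound) (simp add: t)
  with le[of t] have "norm f = \<bar>apply_bcontfun f t\<bar>"
    by linarith
  then show "\<exists>t. norm f = \<bar>apply_bcontfun f t\<bar>" ..
qed

definition polys_le :: "nat \<Rightarrow> C01 set"
  where "polys_le n =
    {g. \<exists>p :: real poly. degree p \<le> n \<and> (\<forall>t. apply_bcontfun g t = poly p (real_of_unit t))}"

definition metric_projection :: "'a::real_normed_vector set \<Rightarrow> 'a \<Rightarrow> 'a set"
  where "metric_projection M f = {p \<in> M. \<forall>q\<in>M. norm (f - p) \<le> norm (f - q)}"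

end

theory Submission
  imports Defs
begin

text \<open>
  Existence is finite-dimensionality. Bounded closed parts of a finite-dimensional subspace are
  compact (\<open>compact_span_Int_cball\<close>), and only elements of norm at most \<open>2 * norm f\<close> can compete
  with \<open>0\<close> as approximations of \<open>f\<close>; so the distance to \<open>f\<close> attains its minimum.

  Uniqueness is special to polynomials and rests on the points where an error function attains
  its norm. A best approximation \<open>r\<close> of degree at most \<open>n\<close> to some \<open>f \<noteq> r\<close> has more than \<open>n\<close> such
  extremal points: if there were at most \<open>n\<close>, some polynomial \<open>s\<close> of degree at most \<open>n\<close> would
  interpolate \<open>f - r\<close> at all of them, and adding a small multiple of \<open>s\<close> to \<open>r\<close> would lower the
  error near the extremal points while keeping it away from its maximum elsewhere
  (\<open>norm_decreases_along_agreeing_direction\<close>). Now let \<open>p\<close> and \<open>q\<close> both be best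
  approximations. Their midpoint \<open>r\<close> is one too. At an extremal point of \<open>f - r\<close> the average of the
  errors \<open>f - p\<close> and \<open>f - q\<close> has the largest modulus that either can have, so the two errors
  coincide there. Thus \<open>p - q\<close> has more than \<open>n\<close> zeros and degree at most \<open>n\<close>; it vanishes.
\<close>

section \<open>Best approximation from a finite-dimensional subspace\<close>

lemma bounded_parts_compact_imp_closed:
  fixes M :: "'a::real_normed_vector set"
  assumes "\<And>r. compact (M \<inter> cball 0 r)"
  shows "closed M"
proof (rule iffD2[OF closed_sequential_limits], intro allI impI, elim conjE)
  fix x l assume x: "\<forall>k. x k \<in> M" and lim: "x \<longlonglongrightarrow> l"
  obtain r where "\<And>k. norm (x k) \<le> r"
    using convergent_imp_bounded[OF lim] by (auto simp: bounded_iff)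
  then have "\<forall>k. x k \<in> M \<inter> cball 0 r"
    using x by simp
  then show "l \<in> M"
    using compact_imp_closed[OF assms, of r] lim closed_sequentially by blast
qed

text \<open>A vector \<open>v\<close> outside the closed set \<open>span B\<close> has positive distance \<open>d\<close> from it. This bounds
  the coefficient \<open>c\<close> of \<open>v\<close> in a combination \<open>x + c *\<^sub>R v\<close> of norm at most \<open>r\<close> by \<open>r / d\<close>, and
  hence also the norm of \<open>x\<close>; so the ball lies in a continuous image of a compact product.\<close>

lemma compact_span_insert_Int_cball:
  fixes v :: "'a::real_normed_vector"
  assumes cpt: "\<And>r. compact (span B \<inter> cball 0 r)"
  shows "compact (span (insert v B) \<inter> cball 0 r)"
proof (cases "v \<in> span B")
  case True
  then show ?thesis
    using cpt by (simp add: span_redundant)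
next
  case False
  define d where "d = infdist v (span B)"
  have ne: "span B \<noteq> {}"
    using span_zero by blast
  have d: "d > 0"
    using False ne bounded_parts_compact_imp_closed[OF cpt]
      in_closed_iff_infdist_zero[of "span B" v] infdist_nonneg[of v "span B"]
    unfolding d_def by force
  have coeff: "\<bar>c\<bar> * d \<le> norm (x + c *\<^sub>R v)" if "x \<in> span B" for x c
  proof (cases "c = 0")
    case False
    have "d \<le> dist v (- (x /\<^sub>R c))"
      unfolding d_def using that by (intro infdist_le span_neg span_scale)
    then have "\<bar>c\<bar> * d \<le> \<bar>c\<bar> * norm (v + x /\<^sub>R c)"
      by (simp add: dist_norm mult_left_mono)
    also have "\<dots> = norm (c *\<^sub>R (v + x /\<^sub>R c))"
      by simp
    also have "c *\<^sub>R (v + x /\<^sub>R c) = x + c *\<^sub>R v"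
      using False by (simp add: algebra_simps)
    finally show ?thesis .
  qed simp
  define C where "C = r / d"
  define R where "R = r + C * norm v"
  define K where
    "K = (\<lambda>(x, c). x + c *\<^sub>R v) ` ((span B \<inter> cball 0 R) \<times> {- C..C})"
  have "compact K"
    unfolding K_def case_prod_beta
    by (intro compact_continuous_image compact_Times cpt compact_Icc continuous_intros)
  moreover have "span (insert v B) \<inter> cball 0 r = K \<inter> cball 0 r"
  proof (intro equalityI subsetI)
    fix y assume y: "y \<in> span (insert v B) \<inter> cball 0 r"
    then obtain c where c: "y - c *\<^sub>R v \<in> span B"
      by (auto simp: span_insert)
    have "\<bar>c\<bar> * d \<le> r"
      using coeff[OF c, of c] y by simp
    then have cC: "\<bar>c\<bar> \<le> C"
      unfolding C_def using d by (simp add: pos_le_divide_eq)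
    have "norm (y - c *\<^sub>R v) \<le> norm y + \<bar>c\<bar> * norm v"
      using norm_triangle_ineq4[of y "c *\<^sub>R v"] by simp
    also have "\<dots> \<le> R"
      unfolding R_def using y cC by (intro add_mono mult_right_mono) auto
    finally have "(y - c *\<^sub>R v, c) \<in> (span B \<inter> cball 0 R) \<times> {- C..C}"
      using c cC by auto
    then have "y \<in> K"
      unfolding K_def by (rule rev_image_eqI) simp
    then show "y \<in> K \<inter> cball 0 r"
      using y by simp
  next
    fix y assume y: "y \<in> K \<inter> cball 0 r"
    then obtain x c where "x \<in> span B" "y = x + c *\<^sub>R v"
      unfolding K_def by auto
    then have "y - c *\<^sub>R v \<in> span B"
      by simp
    then show "y \<in> span (insert v B) \<inter> cball 0 r"
      using y by (auto simp: span_insert)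
  qed
  ultimately show ?thesis
    by (simp add: compact_Int_closed)
qed

lemma compact_span_Int_cball:
  fixes B :: "'a::real_normed_vector set"
  assumes "finite B"
  shows "compact (span B \<inter> cball 0 r)"
  using assms
proof (induction B arbitrary: r)
  case empty
  then show ?case
    by (simp add: finite_imp_compact)
next
  case (insert v B)
  then show ?case
    by (intro compact_span_insert_Int_cball)
qed

lemma metric_projection_span_nonempty:
  fixes B :: "'a::real_normed_vector set"
  assumes "finite B"
  shows "metric_projection (span B) f \<noteq> {}"
proof -
  let ?K = "span B \<inter> cball 0 (2 * norm f)"
  have "0 \<in> ?K"
    by (simp add: span_zero)
  moreover have "continuous_on ?K (\<lambda>p. norm (f - p))"
    by (intro continuous_intros)
  ultimately obtain p where p: "p \<in> ?K" and min: "\<And>q. q \<in> ?K \<Longrightarrow> norm (f - p) \<le> norm (f - q)"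
    using continuous_attains_inf[OF compact_span_Int_cball[OF assms]] by (metis empty_iff)
  have "norm (f - p) \<le> norm (f - q)" if "q \<in> span B" for q
  proof (cases "q \<in> ?K")
    case False
    with that have "norm q > 2 * norm f"
      by simp
    then \<comment> \<open>such a \<open>q\<close> approximates \<open>f\<close> no better than \<open>0\<close> does\<close>
    have "norm f \<le> norm (f - q)"
      using norm_triangle_ineq2[of q f] by (simp add: norm_minus_commute)
    moreover have "norm (f - p) \<le> norm (f - 0)"
      using \<open>0 \<in> ?K\<close> by (rule min)
    ultimately show ?thesis
      by simp
  qed (rule min)
  then show ?thesis
    using p by (auto simp: metric_projection_def)
qed

section \<open>Polynomials as a subspace of the continuous functions\<close>

definition poly_C01 :: "real poly \<Rightarrow> C01"
  where "poly_C01 p = Bcontfun (\<lambda>t. poly p (real_of_unit t))"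

lemma apply_poly_C01 [simp]:
  "apply_bcontfun (poly_C01 p) t = poly p (real_of_unit t)"
proof -
  have "(\<lambda>t. poly p (real_of_unit t)) \<in> bcontfun"
    unfolding bcontfun_unit_interval_iff
    by (intro continuous_intros continuous_on_real_of_unit)
  then show ?thesis
    by (simp add: poly_C01_def Bcontfun_inverse)
qed

lemma polys_le_eq: "polys_le n = poly_C01 ` {p. degree p \<le> n}"
  unfolding polys_le_def by (fastforce simp: image_iff intro: bcontfun_eqI)

lemma poly_C01_eq_sum:
  assumes "degree p \<le> n"
  shows "poly_C01 p = (\<Sum>k\<le>n. coeff p k *\<^sub>R poly_C01 (monom 1 k))"
proof (rule bcontfun_eqI)
  fix t
  have "apply_bcontfun (\<Sum>k\<in>A. coeff p k *\<^sub>R poly_C01 (monom 1 k)) t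
      = (\<Sum>k\<in>A. coeff p k * real_of_unit t ^ k)" if "finite A" for A
    using that by induction (auto simp: poly_monom)
  moreover have "poly p x = (\<Sum>k\<le>n. coeff p k * x ^ k)" for x
    using arg_cong[OF poly_as_sum_of_monoms'[OF assms], of "\<lambda>q. poly q x"]
    by (simp add: poly_sum poly_monom)
  ultimately show "apply_bcontfun (poly_C01 p) t
      = apply_bcontfun (\<Sum>k\<le>n. coeff p k *\<^sub>R poly_C01 (monom 1 k)) t"
    by simp
qed

lemma subspace_polys_le: "subspace (polys_le n)"
proof (rule subspaceI)
  show "0 \<in> polys_le n"
    unfolding polys_le_def by (auto intro!: exI[of _ 0])
  show "x + y \<in> polys_le n" if xy: "x \<in> polys_le n" "y \<in> polys_le n" for x y
  proof -
    obtain p q where "x = poly_C01 p" "degree p \<le> n" "y = poly_C01 q" "degree q \<le> n"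
      using xy by (auto simp: polys_le_eq)
    then have "degree (p + q) \<le> n"
      and "\<forall>t. apply_bcontfun (x + y) t = poly (p + q) (real_of_unit t)"
      by (simp_all add: degree_add_le)
    then show ?thesis
      unfolding polys_le_def by blast
  qed
  show "c *\<^sub>R x \<in> polys_le n" if x: "x \<in> polys_le n" for c x
  proof -
    obtain p where "x = poly_C01 p" "degree p \<le> n"
      using x by (auto simp: polys_le_eq)
    then have "degree (smult c p) \<le> n"
      and "\<forall>t. apply_bcontfun (c *\<^sub>R x) t = poly (smult c p) (real_of_unit t)"
      by (simp_all add: order_trans[OF degree_smult_le])
    then show ?thesis
      unfolding polys_le_def by blast
  qed
qed

lemma polys_le_eq_span: "polys_le n = span ((\<lambda>k. poly_C01 (monom 1 k)) ` {..n})"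
proof
  show "polys_le n \<subseteq> span ((\<lambda>k. poly_C01 (monom 1 k)) ` {..n})"
    unfolding polys_le_eq
    by (auto simp: poly_C01_eq_sum intro!: span_sum span_scale intro: span_base)
  show "span ((\<lambda>k. poly_C01 (monom 1 k)) ` {..n}) \<subseteq> polys_le n"
    using subspace_polys_le
    by (intro span_minimal) (auto simp: polys_le_eq intro: order_trans[OF degree_monom_le])
qed

section \<open>Extremal points of the error of a best approximation\<close>

text \<open>The bound on the degree is one more than Lagrange interpolation gives for a nonempty \<open>Z\<close>.
  In this form a Newton step works uniformly: the correction at a new node is a multiple of the
  product \<open>w\<close> over the old nodes, of degree \<open>card Z\<close>.\<close>

lemma exists_interpolating_poly:
  fixes y :: "'a::field \<Rightarrow> 'a"
  assumes "finite Z"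
  shows "\<exists>p. degree p \<le> card Z \<and> (\<forall>z\<in>Z. poly p z = y z)"
  using assms
proof (induction Z)
  case empty
  show ?case
    by (auto intro: exI[of _ 0])
next
  case (insert a Z)
  then obtain p where p: "degree p \<le> card Z" "\<And>z. z \<in> Z \<Longrightarrow> poly p z = y z"
    by blast
  define w where "w = (\<Prod>z\<in>Z. [:- z, 1:])"
  have w: "degree w \<le> card Z" "poly w a \<noteq> 0" "\<And>z. z \<in> Z \<Longrightarrow> poly w z = 0"
    using insert.hyps degree_prod_sum_le[of Z "\<lambda>z. [:- z, 1:]"]
    by (auto simp: w_def poly_prod)
  define c where "c = (y a - poly p a) / poly w a"
  have "degree (p + smult c w) \<le> card Z"
    using p(1) w(1) by (intro degree_add_le order_trans[OF degree_smult_le])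
  moreover have "poly (p + smult c w) z = y z" if "z \<in> insert a Z" for z
    using that p(2) w(2,3) by (auto simp: c_def)
  ultimately show ?case
    using insert.hyps by (auto intro!: exI[of _ "p + smult c w"])
qed

definition extremal_points :: "C01 \<Rightarrow> unit_interval set"
  where "extremal_points g = {t. \<bar>apply_bcontfun g t\<bar> = norm g}"

text \<open>One half of Kolmogorov's criterion for best approximation. Let \<open>N\<close> be the closed set where
  \<open>g\<close> and \<open>s\<close> do not have the same strict sign. It contains no extremal point, so by compactness
  \<open>g\<close> is bounded on it by some \<open>m < norm g\<close>, which leaves room for a small multiple of \<open>s\<close>.
  Off \<open>N\<close>, subtracting that multiple either brings the value of \<open>g\<close> closer to \<open>0\<close>, or overshoots
  \<open>0\<close> by less than the norm of the multiple. The resulting strict bound at each point passes to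
  the norm, because the norm is attained.\<close>

lemma norm_decreases_along_agreeing_direction:
  fixes g s :: C01
  assumes agree: "\<And>t. t \<in> extremal_points g \<Longrightarrow>
    0 < apply_bcontfun g t * apply_bcontfun s t"
  shows "\<exists>c. norm (g - c *\<^sub>R s) < norm g"
proof -
  note le = norm_C01_is_max(2)
  define N where "N = {t. apply_bcontfun g t * apply_bcontfun s t \<le> 0}"
  have "closed N"
    unfolding N_def by (intro closed_Collect_le continuous_intros) auto
  then have cN: "compact N"
    using compact_Int_closed[OF compact_UNIV_unit_interval] by simp
  have "g \<noteq> 0"
    using agree by (auto simp: extremal_points_def)
  then have gpos: "norm g > 0"
    by simp
  have "\<exists>m. 0 \<le> m \<and> m < norm g \<and> (\<forall>t\<in>N. \<bar>apply_bcontfun g t\<bar> \<le> m)"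
  proof (cases "N = {}")
    case True
    then show ?thesis
      using gpos by auto
  next
    case False
    have "continuous_on N (\<lambda>t. \<bar>apply_bcontfun g t\<bar>)"
      by (intro continuous_intros) auto
    then obtain u where u: "u \<in> N" "\<forall>t\<in>N. \<bar>apply_bcontfun g t\<bar> \<le> \<bar>apply_bcontfun g u\<bar>"
      using continuous_attains_sup[OF cN False] by blast
    have "\<bar>apply_bcontfun g u\<bar> \<noteq> norm g"
      using u(1) agree[of u] unfolding N_def extremal_points_def by force
    then show ?thesis
      using u(2) le[of g u] by (intro exI[of _ "\<bar>apply_bcontfun g u\<bar>"]) auto
  qed
  then obtain m where m: "0 \<le> m" "m < norm g" "\<And>t. t \<in> N \<Longrightarrow> \<bar>apply_bcontfun g t\<bar> \<le> m"
    by blast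
  \<comment> \<open>the summand 1 makes the bound \<open>m + c * norm s < norm g\<close> strict\<close>
  define c where "c = (norm g - m) / (norm s + 1)"
  have c: "c > 0"
    unfolding c_def using m(2) by (intro divide_pos_pos) (auto simp: add_nonneg_pos)
  have "c * (norm s + 1) = norm g - m"
    unfolding c_def using norm_ge_zero[of s] by (simp add: add_nonneg_eq_0_iff)
  then have cs: "m + c * norm s < norm g"
    using c by (simp add: algebra_simps)
  have "\<bar>apply_bcontfun g t - c * apply_bcontfun s t\<bar> < norm g" for t
  proof -
    have st: "c * \<bar>apply_bcontfun s t\<bar> \<le> c * norm s"
      using c le[of s t] by simp
    show ?thesis
    proof (cases "t \<in> N")
      case True
      have "\<bar>apply_bcontfun g t - c * apply_bcontfun s t\<bar>
          \<le> \<bar>apply_bcontfun g t\<bar> + c * \<bar>apply_bcontfun s t\<bar>"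
        using c abs_triangle_ineq4[of "apply_bcontfun g t" "c * apply_bcontfun s t"]
        by (simp add: abs_mult)
      then show ?thesis
        using m(3)[OF True] st cs by linarith
    next
      case False
      then consider "apply_bcontfun g t > 0" "c * apply_bcontfun s t > 0"
        | "apply_bcontfun g t < 0" "c * apply_bcontfun s t < 0"
        using c by (auto simp: N_def not_le zero_less_mult_iff mult_less_0_iff)
      moreover have "\<bar>c * apply_bcontfun s t\<bar> < norm g"
        unfolding abs_mult using st cs c m(1) by linarith
      ultimately show ?thesis
        using le[of g t] by cases linarith+
    qed
  qed
  moreover obtain t where "norm (g - c *\<^sub>R s) = \<bar>apply_bcontfun (g - c *\<^sub>R s) t\<bar>"
    using norm_C01_is_max(1) by blast
  ultimately have "norm (g - c *\<^sub>R s) < norm g"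
    by simp
  then show ?thesis ..
qed

text \<open>If there were at most \<open>n\<close> extremal points, interpolating the error there by a polynomial of
  degree at most \<open>n\<close> would yield a direction in which the error can be decreased.\<close>

lemma many_extremal_points_of_best_approximation:
  assumes r: "r \<in> metric_projection (polys_le n) f"
    and nz: "f \<noteq> r"
    and fin: "finite (extremal_points (f - r))"
  shows "n < card (extremal_points (f - r))"
proof (rule ccontr)
  let ?Z = "extremal_points (f - r)"
  assume "\<not> n < card ?Z"
  moreover have inj: "inj real_of_unit"
    by (simp add: inj_def real_of_unit_inject)
  ultimately have card: "card (real_of_unit ` ?Z) \<le> n"
    by (simp add: card_image inj_on_subset[OF inj])
  obtain p where p: "degree p \<le> card (real_of_unit ` ?Z)"
    "\<And>z. z \<in> real_of_unit ` ?Z \<Longrightarrow> poly p z = apply_bcontfun (f - r) (unit_of_real z)"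
    using exists_interpolating_poly[OF finite_imageI[OF fin],
        of real_of_unit "\<lambda>z. apply_bcontfun (f - r) (unit_of_real z)"] by blast
  have s: "poly_C01 p \<in> polys_le n"
    using p(1) card by (auto simp: polys_le_eq)
  have "0 < apply_bcontfun (f - r) t * apply_bcontfun (poly_C01 p) t"
    if t: "t \<in> extremal_points (f - r)" for t
  proof -
    have "apply_bcontfun (poly_C01 p) t = apply_bcontfun (f - r) t"
      using p(2)[of "real_of_unit t"] t by (simp add: real_of_unit_inverse)
    moreover have "apply_bcontfun (f - r) t \<noteq> 0"
      using t nz by (auto simp: extremal_points_def simp del: minus_bcontfun.rep_eq)
    ultimately show ?thesis
      by (metis not_real_square_gt_zero)
  qed
  then obtain c where c: "norm (f - r - c *\<^sub>R poly_C01 p) < norm (f - r)"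
    using norm_decreases_along_agreeing_direction by blast
  have "r + c *\<^sub>R poly_C01 p \<in> polys_le n"
    using r s subspace_polys_le
    by (auto simp: metric_projection_def intro: subspace_add subspace_scale)
  then have "norm (f - r) \<le> norm (f - (r + c *\<^sub>R poly_C01 p))"
    using r by (simp add: metric_projection_def)
  with c show False
    by (simp add: algebra_simps)
qed

section \<open>Uniqueness\<close>

lemma metric_projection_midpoint:
  fixes p q :: "'a::real_normed_vector"
  assumes M: "subspace M" and p: "p \<in> metric_projection M f" and q: "q \<in> metric_projection M f"
  shows "midpoint p q \<in> metric_projection M f"
proof -
  have eq: "norm (f - p) = norm (f - q)"
    using p q by (simp add: metric_projection_def order_antisym)
  have "f - midpoint p q = (1/2) *\<^sub>R ((f - p) + (f - q))"
    by (simp add: midpoint_def algebra_simps flip: scaleR_add_left)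
  then have "norm (f - midpoint p q) = norm ((f - p) + (f - q)) / 2"
    by simp
  also have "\<dots> \<le> norm (f - p)"
    using norm_triangle_ineq[of "f - p" "f - q"] eq by simp
  finally show ?thesis
    using p q M
    by (auto simp: metric_projection_def midpoint_def subspace_add subspace_scale
        intro: order_trans)
qed

lemma best_approximation_polys_unique:
  assumes p: "p \<in> metric_projection (polys_le n) f" and q: "q \<in> metric_projection (polys_le n) f"
  shows "p = q"
proof (rule ccontr)
  assume ne: "p \<noteq> q"
  define r where "r = midpoint p q"
  have r: "r \<in> metric_projection (polys_le n) f"
    unfolding r_def using subspace_polys_le p q by (rule metric_projection_midpoint)
  have eq: "norm (f - p) = norm (f - r)" "norm (f - q) = norm (f - r)"
    using p q r by (auto simp: metric_projection_def intro: order_antisym)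
  then have nz: "f \<noteq> r"
    using ne by auto
  let ?Z = "extremal_points (f - r)"
  have pq_Z: "apply_bcontfun p t = apply_bcontfun q t" if "t \<in> ?Z" for t
  proof -
    have "apply_bcontfun (f - r) t = (apply_bcontfun (f - p) t + apply_bcontfun (f - q) t) / 2"
      by (simp add: r_def midpoint_def field_simps)
    moreover have "\<bar>apply_bcontfun (f - p) t\<bar> \<le> norm (f - r)" "\<bar>apply_bcontfun (f - q) t\<bar> \<le> norm (f - r)"
      using norm_C01_is_max(2) eq by metis+
    \<comment> \<open>an average of two numbers in an interval \<open>[-E, E]\<close> is an endpoint only if both are\<close>
    ultimately have "apply_bcontfun (f - p) t = apply_bcontfun (f - q) t"
      using that by (simp add: extremal_points_def abs_if split: if_splits)
    then show ?thesis
      by simp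
  qed
  have "p - q \<in> polys_le n"
    using p q subspace_polys_le by (auto simp: metric_projection_def intro: subspace_diff)
  then obtain w where w: "degree w \<le> n" "p - q = poly_C01 w"
    by (auto simp: polys_le_eq)
  have "w \<noteq> 0"
    using ne w(2) by (metis apply_poly_C01 bcontfun_eqI poly_0 right_minus_eq zero_bcontfun.rep_eq)
  have sub: "real_of_unit ` ?Z \<subseteq> {x. poly w x = 0}"
  proof clarify
    fix t assume "t \<in> ?Z"
    then have "apply_bcontfun (p - q) t = 0"
      using pq_Z[of t] by simp
    then show "poly w (real_of_unit t) = 0"
      using w(2) by simp
  qed
  have inj: "inj_on real_of_unit ?Z"
    by (simp add: inj_on_def real_of_unit_inject)
  have fin: "finite ?Z"
    using sub inj poly_roots_finite[OF \<open>w \<noteq> 0\<close>] by (metis finite_imageD finite_subset)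
  have "card ?Z = card (real_of_unit ` ?Z)"
    using inj by (simp add: card_image)
  also have "\<dots> \<le> card {x. poly w x = 0}"
    using sub poly_roots_finite[OF \<open>w \<noteq> 0\<close>] by (rule card_mono[rotated])
  also have "\<dots> \<le> n"
    using card_poly_roots_bound[OF \<open>w \<noteq> 0\<close>] w(1) by simp
  finally show False
    using many_extremal_points_of_best_approximation[OF r nz fin] by simp
qed

theorem theorem5p4:
  fixes n :: nat
  shows "\<forall>f :: C01. \<exists>!p. p \<in> metric_projection (polys_le n) f"
proof
  fix f :: C01
  have "metric_projection (polys_le n) f \<noteq> {}"
    unfolding polys_le_eq_span by (rule metric_projection_span_nonempty) simp
  then show "\<exists>!p. p \<in> metric_projection (polys_le n) f"
    using best_approximation_polys_unique by blast
qed

end
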